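(* Let $m,\Theta,N_0,L,\mathrm{SNR}_{\mathrm{th}}>0$, $0<T_f<T_b$, and let $P_b,H,P_{\mathrm{hov}},\gamma_d\ge0$ be real numbers such that $$P_d^*:=\frac{(P_bT_b+HT_f)-(P_{\mathrm{hov}}+\gamma_d)T_f}{T_b-T_f}>0.$$ Consider the problem of minimizing over $P_d>0$ the SNR outage $$\frac{\gamma\!\left(m,\frac{\mathrm{SNR}_{\mathrm{th}}N_0}{\Theta L P_d}\right)}{\Gamma(m)}\quad\text{subject to}\quad P_d\le\frac{(P_bT_b+HT_f)-(P_{\mathrm{hov}}+\gamma_d)T_f}{T_b-T_f}.$$ Then the optimal solution is $P_d=P_d^*$.
   Context: $\gamma(m,x)=\int_0^x t^{m-1}e^{-t}dt$ is the lower incomplete Gamma function and $\Gamma$ the Gamma function. $P_d$ is the UAV transmit power, $T_f$ its flight time, $T_b$ the total block duration, $P_b$ the battery power, $H$ the harvested power, $P_{\mathrm{hov}}$ the hovering power, $\gamma_d$ the activation power, $L$ the (linear-scale) path-loss gain to the user, $N_0$ the noise power, $\mathrm{SNR}_{\mathrm{th}}$ the SNR threshold, and $m,\Theta$ the shape and scale parameters of the Gamma-distributed channel fading; all except $P_d$ are fixed constants. *)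

theory Defs
  imports "HOL-Analysis.Analysis"
begin

definition lower_inc_gamma :: "real \<Rightarrow> real \<Rightarrow> real" where
  "lower_inc_gamma m x = integral {0..x} (\<lambda>t. t powr (m - 1) * exp (- t))"

definition snr_outage :: "real \<Rightarrow> real \<Rightarrow> real \<Rightarrow> real \<Rightarrow> real \<Rightarrow> real \<Rightarrow> real" where
  "snr_outage m \<Theta> N0 L SNRth Pd =
     lower_inc_gamma m (SNRth * N0 / (\<Theta> * L * Pd)) / Gamma m"

definition max_transmit_power ::
    "real \<Rightarrow> real \<Rightarrow> real \<Rightarrow> real \<Rightarrow> real \<Rightarrow> real \<Rightarrow> real" where
  "max_transmit_power Tf Tb Pb H Phov \<gamma>d =
     ((Pb * Tb + H * Tf) - (Phov + \<gamma>d) * Tf) / (Tb - Tf)"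

end

theory Submission
  imports Defs
begin

text \<open>The integrand of the lower incomplete Gamma function is positive for t > 0, so the
  integral grows strictly with its upper limit (\<open>lower_inc_gamma_strict_mono\<close>). More
  power lowers that limit, hence strictly lowers the outage
  (\<open>snr_outage_strict_antimono\<close>). A strictly decreasing objective on (0,
  \<open>Pstar\<close>] has the right endpoint as its only minimizer.\<close>

lemma gamma_integrand_integrable:
  fixes m x :: real
  assumes "m > 0"
  shows "(\<lambda>t. t powr (m - 1) * exp (- t)) integrable_on {0..x}"
proof -
  have "(\<lambda>t. t powr (m - 1) / exp t) integrable_on {0..x}"
    \<comment> \<open>Euler's integral for \<open>Gamma m\<close> converges on the whole half-line,
      which covers the singularity at 0 when m < 1.\<close>
    using Gamma_integral_real[OF assms]
    by (intro integrable_on_subinterval[where S = "{0..}"]) (auto simp: integrable_on_def)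
  then show ?thesis
    by (simp add: exp_minus field_simps)
qed

lemma lower_inc_gamma_strict_mono:
  assumes "m > 0" "0 < x" "x < y"
  shows "lower_inc_gamma m x < lower_inc_gamma m y"
proof -
  let ?f = "\<lambda>t::real. t powr (m - 1) * exp (- t)"
  \<comment> \<open>Since x > 0, the interval avoids 0, where continuity fails for m \<le> 1. The
    minimum of \<open>?f\<close> is then attained and positive, and bounds the added integral from
    below.\<close>
  have "continuous_on {x..y} ?f"
    using assms by (intro continuous_intros) auto
  then obtain c where c: "c \<in> {x..y}" "\<And>t. t \<in> {x..y} \<Longrightarrow> ?f c \<le> ?f t"
    using continuous_attains_inf[of "{x..y}" ?f] assms by auto
  have int: "?f integrable_on {x..y}"
    using assms by (intro integrable_on_subinterval[OF gamma_integrand_integrable[of m y]]) auto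
  have "0 < ?f c * (y - x)"
    using assms c(1) by simp
  also have "\<dots> = integral {x..y} (\<lambda>_. ?f c)"
    using assms by simp
  also have "\<dots> \<le> integral {x..y} ?f"
    using int c(2) by (intro integral_le integrable_const_ivl) auto
  finally have "0 < integral {x..y} ?f" .
  moreover have "integral {0..x} ?f + integral {x..y} ?f = integral {0..y} ?f"
    using assms gamma_integrand_integrable by (intro Henstock_Kurzweil_Integration.integral_combine) auto
  ultimately show ?thesis
    unfolding lower_inc_gamma_def by linarith
qed

lemma snr_outage_strict_antimono:
  assumes "m > 0" "\<Theta> > 0" "N0 > 0" "L > 0" "SNRth > 0" "0 < P" "P < Q"
  shows "snr_outage m \<Theta> N0 L SNRth Q < snr_outage m \<Theta> N0 L SNRth P"
  unfolding snr_outage_def using assms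
  by (intro divide_strict_right_mono lower_inc_gamma_strict_mono Gamma_real_pos
      divide_strict_left_mono mult_strict_left_mono) auto

theorem mainTheorem7:
  fixes m \<Theta> N0 L SNRth Tf Tb Pb H Phov \<gamma>d Pstar :: real
  assumes "m > 0" and "\<Theta> > 0" and "N0 > 0" and "L > 0" and "SNRth > 0"
    and "0 < Tf" and "Tf < Tb"
    and "Pb \<ge> 0" and "H \<ge> 0" and "Phov \<ge> 0" and "\<gamma>d \<ge> 0"
    and "Pstar = max_transmit_power Tf Tb Pb H Phov \<gamma>d"
    and "Pstar > 0"
  shows "\<forall>P. is_arg_min (\<lambda>Pd. snr_outage m \<Theta> N0 L SNRth Pd)
               (\<lambda>Pd. 0 < Pd \<and> Pd \<le> max_transmit_power Tf Tb Pb H Phov \<gamma>d) P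
             \<longleftrightarrow> P = Pstar"
proof -
  have "snr_outage m \<Theta> N0 L SNRth Pstar < snr_outage m \<Theta> N0 L SNRth P"
    if "0 < P" "P < Pstar" for P
    using snr_outage_strict_antimono assms(1-5) that by blast
  then show ?thesis
    \<comment> \<open>\<open>is_arg_min\<close> asks that no feasible point be strictly better:
      \<open>Pstar\<close> beats every other feasible \<open>P\<close>, and by asymmetry none beats
      \<open>Pstar\<close>.\<close>
    unfolding is_arg_min_def assms(12)[symmetric] using \<open>Pstar > 0\<close>
    by (metis less_asym order_le_less order.refl)
qed

end
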